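(* Let $u=u_1\cdots u_r$ be an allowed word of $\Sigma_A$ with $r\ge2$ whose weighted autocorrelation polynomial satisfies $\tau_u(z)=1+z^{r-1}\delta_u$. If $w=w_1\cdots w_r\in\mathcal L_r$ satisfies $w_1=u_1=u_r=w_r$ and $\delta_w=\delta_u$, then $\rho(C_w)\le\rho(C_u)$.
   Context: Let $\Sigma=\{1,\dots,N\}$, $A$ an irreducible $N\times N$ $0$–$1$ matrix, $\Sigma_A=\{x\in\Sigma^{\mathbb N}:A_{x_nx_{n+1}}=1\ \forall n\}$ with left shift $\sigma$; $\mathcal L_r$ is the set of allowed words of length $r$; $C_u$ is the set of $x\in\Sigma_A$ beginning with $u$. $P$ is a row-stochastic matrix with $P_{ij}>0$ iff $A_{ij}=1$, $\mathbf p$ its stationary vector, $\mu=\mu_P$ the Markov measure $\mu(C_v)=p_{v_1}P_{v_1v_2}\cdots P_{v_{n-1}v_n}$. For a hole $H$, $\mathcal W_m=\{x:\sigma^ix\notin H,0\le i\le m\}$ and $\rho(H)=-\lim_m\frac1m\ln\mu(\mathcal W_m)$. For $v=v_1\cdots v_r$: $\delta_v=P_{v_1v_2}\cdots P_{v_{r-1}v_r}$; for $0\le s\le r-1$, $c_{s,v,v}=1$ if $v_{s+1}\cdots v_r=v_1\cdots v_{r-s}$ and $0$ otherwise; $\delta_{s,v,v}=\prod_{j=r-s}^{r-1}P_{v_jv_{j+1}}$ (empty product $=1$); $\tau_v(z)=\sum_{s=0}^{r-1}c_{s,v,v}\delta_{s,v,v}z^s$. *)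

theory Defs
  imports "HOL-Probability.Probability" "HOL-Computational_Algebra.Polynomial"
begin

text \<open>Alphabet is {1..N}; words are lists (index 0 of a list = letter v_1 of the paper);
  points of the full shift are functions nat => nat (x 0 = x_1).\<close>

definition allowed_word :: "nat \<Rightarrow> (nat \<Rightarrow> nat \<Rightarrow> nat) \<Rightarrow> nat list \<Rightarrow> bool" where
  "allowed_word N A v \<longleftrightarrow> v \<noteq> [] \<and> set v \<subseteq> {1..N} \<and>
     (\<forall>i. Suc i < length v \<longrightarrow> A (v!i) (v!Suc i) = 1)"

definition lang :: "nat \<Rightarrow> (nat \<Rightarrow> nat \<Rightarrow> nat) \<Rightarrow> nat \<Rightarrow> nat list set" where
  "lang N A r = {v. allowed_word N A v \<and> length v = r}"

definition zero_one_matrix :: "nat \<Rightarrow> (nat \<Rightarrow> nat \<Rightarrow> nat) \<Rightarrow> bool" where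
  "zero_one_matrix N A \<longleftrightarrow> (\<forall>i\<in>{1..N}. \<forall>j\<in>{1..N}. A i j \<in> {0,1})"

fun matpow :: "nat \<Rightarrow> (nat \<Rightarrow> nat \<Rightarrow> nat) \<Rightarrow> nat \<Rightarrow> nat \<Rightarrow> nat \<Rightarrow> nat" where
  "matpow N A 0 i j = (if i = j then 1 else 0)"
| "matpow N A (Suc n) i j = (\<Sum>k=1..N. matpow N A n i k * A k j)"

definition irreducible_matrix :: "nat \<Rightarrow> (nat \<Rightarrow> nat \<Rightarrow> nat) \<Rightarrow> bool" where
  "irreducible_matrix N A \<longleftrightarrow> (\<forall>i\<in>{1..N}. \<forall>j\<in>{1..N}. \<exists>n\<ge>1. matpow N A n i j > 0)"

definition row_stochastic_compatible ::
  "nat \<Rightarrow> (nat \<Rightarrow> nat \<Rightarrow> nat) \<Rightarrow> (nat \<Rightarrow> nat \<Rightarrow> real) \<Rightarrow> bool" where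
  "row_stochastic_compatible N A P \<longleftrightarrow>
     (\<forall>i\<in>{1..N}. \<forall>j\<in>{1..N}. P i j \<ge> 0 \<and> (P i j > 0 \<longleftrightarrow> A i j = 1)) \<and>
     (\<forall>i\<in>{1..N}. (\<Sum>j=1..N. P i j) = 1)"

definition stationary_vector :: "nat \<Rightarrow> (nat \<Rightarrow> nat \<Rightarrow> real) \<Rightarrow> (nat \<Rightarrow> real) \<Rightarrow> bool" where
  "stationary_vector N P p \<longleftrightarrow>
     (\<forall>i\<in>{1..N}. p i \<ge> 0) \<and> (\<Sum>i=1..N. p i) = 1 \<and>
     (\<forall>j\<in>{1..N}. (\<Sum>i=1..N. p i * P i j) = p j)"

definition delta :: "(nat \<Rightarrow> nat \<Rightarrow> real) \<Rightarrow> nat list \<Rightarrow> real" where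
  "delta P v = (\<Prod>i<length v - 1. P (v!i) (v!Suc i))"

definition cself :: "nat \<Rightarrow> nat list \<Rightarrow> real" where
  "cself s v = (if drop s v = take (length v - s) v then 1 else 0)"

text \<open>delta_{s,v,v} = prod_{j=r-s}^{r-1} P_{v_j v_{j+1}} (1-based letters)\<close>
definition delta_self :: "(nat \<Rightarrow> nat \<Rightarrow> real) \<Rightarrow> nat \<Rightarrow> nat list \<Rightarrow> real" where
  "delta_self P s v = (\<Prod>j\<in>{length v - s..length v - 1}. P (v!(j-1)) (v!j))"

definition tau :: "(nat \<Rightarrow> nat \<Rightarrow> real) \<Rightarrow> nat list \<Rightarrow> real poly" where
  "tau P v = (\<Sum>s<length v. monom (cself s v * delta_self P s v) s)"

definition full_shift :: "nat \<Rightarrow> (nat \<Rightarrow> nat) measure" where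
  "full_shift N = (\<Pi>\<^sub>M i\<in>UNIV. count_space {1..N})"

definition SigmaA :: "nat \<Rightarrow> (nat \<Rightarrow> nat \<Rightarrow> nat) \<Rightarrow> (nat \<Rightarrow> nat) set" where
  "SigmaA N A = {x. (\<forall>n. x n \<in> {1..N}) \<and> (\<forall>n. A (x n) (x (Suc n)) = 1)}"

definition shift :: "(nat \<Rightarrow> nat) \<Rightarrow> (nat \<Rightarrow> nat)" where
  "shift x = (\<lambda>n. x (Suc n))"

definition cyl :: "nat \<Rightarrow> (nat \<Rightarrow> nat \<Rightarrow> nat) \<Rightarrow> nat list \<Rightarrow> (nat \<Rightarrow> nat) set" where
  "cyl N A v = {x \<in> SigmaA N A. \<forall>i<length v. x i = v!i}"

text \<open>mu is the Markov measure mu_P: a probability measure on the full shift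
  (product sigma algebra) whose value on every cylinder [v] is p_{v1} P_{v1v2}...;
  it is concentrated on Sigma_A.\<close>
definition markov_measure ::
  "nat \<Rightarrow> (nat \<Rightarrow> nat \<Rightarrow> real) \<Rightarrow> (nat \<Rightarrow> real) \<Rightarrow> (nat \<Rightarrow> nat) measure \<Rightarrow> bool" where
  "markov_measure N P p M \<longleftrightarrow> prob_space M \<and> sets M = sets (full_shift N) \<and>
     (\<forall>v. v \<noteq> [] \<longrightarrow> set v \<subseteq> {1..N} \<longrightarrow>
        measure M {x \<in> space M. \<forall>i<length v. x i = v!i} = p (hd v) * delta P v)"

definition survivors ::
  "nat \<Rightarrow> (nat \<Rightarrow> nat \<Rightarrow> nat) \<Rightarrow> (nat \<Rightarrow> nat) set \<Rightarrow> nat \<Rightarrow> (nat \<Rightarrow> nat) set" where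
  "survivors N A H m = {x \<in> SigmaA N A. \<forall>i\<le>m. (shift ^^ i) x \<notin> H}"

definition escape_rate ::
  "nat \<Rightarrow> (nat \<Rightarrow> nat \<Rightarrow> nat) \<Rightarrow> (nat \<Rightarrow> nat) measure \<Rightarrow> (nat \<Rightarrow> nat) set \<Rightarrow> real" where
  "escape_rate N A M H = - lim (\<lambda>m. ln (measure M (survivors N A H m)) / real m)"

end

theory Submission
  imports Defs "HOL-Library.Sublist" "HOL-Computational_Algebra.Formal_Power_Series"
begin

text \<open>
  Let \<open>a\<close> be the common first and last letter. For a word \<open>v\<close> let \<open>T\<^sub>v\<close> and \<open>S\<^sub>v\<close> be the generating
  functions of the total weights of words ending in their first occurrence of \<open>v\<close>, respectively
  avoiding \<open>v\<close>, and let \<open>G\<close>, \<open>E\<close> be those of all words ending in \<open>a\<close>, started at \<open>a\<close> or according to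
  \<open>p\<close>. Cutting a word at its first occurrence of \<open>v\<close>, and appending \<open>v\<close> to a word that avoids it,
  give with \<open>D = \<delta> z\<^bsup>r-1\<^esup>\<close> the relation \<open>E D = T\<^sub>v (\<tau>\<^sub>v - D + G D)\<close>. Since \<open>\<tau>\<^sub>u - D = 1\<close>, eliminating \<open>E\<close>
  yields \<open>S\<^sub>w - S\<^sub>u = T\<^sub>w (\<tau>\<^sub>w - \<tau>\<^sub>u) S\<^sub>u\<^sup>a\<close>, where \<open>S\<^sub>u\<^sup>a\<close> is \<open>S\<^sub>u\<close> started at \<open>a\<close>. All coefficients on
  the right are nonnegative, so at every time at least as much mass survives the hole at \<open>w\<close> as the
  hole at \<open>u\<close>. The limits defining the escape rates exist by Fekete's lemma.

  As \<open>ln 0 = 0\<close>, a hole that swallows everything in finite time has escape rate \<open>0\<close> instead of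
  \<open>\<infinity>\<close>. For the hole at \<open>u\<close> this happens only if the graph is a single cycle, and then \<open>w = u\<close>.
\<close>

section \<open>Words and their weights\<close>

lemma delta_Cons_Cons: "delta P (x # y # zs) = P x y * delta P (y # zs)"
  by (simp add: delta_def prod.lessThan_Suc_shift del: prod.lessThan_Suc)

lemma delta_singleton [simp]: "delta P [x] = 1"
  by (simp add: delta_def)

lemma delta_append:
  assumes "xs \<noteq> []"
  shows "delta P (xs @ zs) = delta P xs * delta P (last xs # zs)"
  using assms
proof (induction xs rule: induct_list012)
  case (3 x y xs)
  then show ?case by (simp add: delta_Cons_Cons)
qed auto

text \<open>The product runs over the last \<open>s\<close> transitions of \<open>v\<close>, which
  are those inside its suffix of length \<open>s + 1\<close>.\<close>

lemma delta_self_eq_delta_drop: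
  assumes "s < length v"
  shows "delta_self P s v = delta P (drop (length v - Suc s) v)"
proof -
  have "delta_self P s v = (\<Prod>i<s. P (v ! (length v - Suc s + i)) (v ! (length v - s + i)))"
    unfolding delta_self_def
    by (rule prod.reindex_bij_witness[where i = "\<lambda>i. length v - s + i" and j = "\<lambda>j. j - (length v - s)"])
       (use assms in \<open>auto simp: Suc_diff_Suc intro!: arg_cong2[where f = P] arg_cong[where f = "(!) v"]\<close>)
  also have "\<dots> = delta P (drop (length v - Suc s) v)"
    unfolding delta_def using assms
    by (intro prod.cong) (auto intro!: arg_cong2[where f = P] arg_cong[where f = "(!) v"])
  finally show ?thesis .
qed

lemma sublist_snoc_iff: "sublist w (v @ [b]) \<longleftrightarrow> suffix w (v @ [b]) \<or> sublist w v"
proof -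
  have "sublist w (v @ [b]) \<Longrightarrow> suffix w (v @ [b]) \<or> sublist w v"
  proof -
    assume "sublist w (v @ [b])"
    then obtain ps ss where e: "v @ [b] = ps @ w @ ss" by (auto simp: sublist_def)
    show ?thesis
    proof (cases ss rule: rev_cases)
      case Nil
      then show ?thesis using e by (auto simp: suffix_def)
    next
      case (snoc ys y)
      then have "v = ps @ w @ ys" using e by simp
      then show ?thesis by (auto simp: sublist_def)
    qed
  qed
  then show ?thesis by (auto intro: suffix_imp_sublist sublist_order.order.trans)
qed

definition words :: "nat \<Rightarrow> nat \<Rightarrow> nat list set" where
  "words N n = {v. length v = n \<and> set v \<subseteq> {1..N}}"

lemma finite_words [simp]: "finite (words N n)"
proof -
  have "words N n = {v. set v \<subseteq> {1..N} \<and> length v = n}" by (auto simp: words_def)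
  then show ?thesis by (simp add: finite_lists_length_eq)
qed

lemma sum_words_append:
  fixes f :: "nat list \<Rightarrow> 'a::comm_monoid_add"
  shows "(\<Sum>v\<in>words N (m + n). f v) = (\<Sum>x\<in>words N m. \<Sum>y\<in>words N n. f (x @ y))"
  unfolding sum.cartesian_product
  by (rule sum.reindex_bij_witness[where i = "\<lambda>(x, y). x @ y" and j = "\<lambda>v. (take m v, drop m v)"])
     (auto simp: words_def dest: in_set_takeD in_set_dropD)

lemma sum_words_1:
  fixes f :: "nat list \<Rightarrow> 'a::comm_monoid_add"
  shows "(\<Sum>v\<in>words N (Suc 0). f v) = (\<Sum>b=1..N. f [b])"
  by (rule sum.reindex_bij_witness[where i = "\<lambda>b. [b]" and j = hd])
     (auto simp: words_def length_Suc_conv)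

lemma sum_words_snoc:
  fixes f :: "nat list \<Rightarrow> 'a::comm_monoid_add"
  shows "(\<Sum>v\<in>words N (Suc n). f v) = (\<Sum>v\<in>words N n. \<Sum>b=1..N. f (v @ [b]))"
  using sum_words_append[where m = n and n = "Suc 0"] by (simp add: sum_words_1)

lemma words_nonempty: "v \<in> words N (Suc n) \<Longrightarrow> v \<noteq> []"
  by (auto simp: words_def)

lemma hd_last_words:
  assumes "v \<in> words N (Suc n)"
  shows "hd v \<in> {1..N}" "last v \<in> {1..N}"
  using assms hd_in_set[of v] last_in_set[of v] words_nonempty[OF assms]
  unfolding words_def by blast+

lemma not_sublist_singleton:
  assumes "length w \<ge> 2" "length v = Suc 0"
  shows "\<not> sublist w v"
  using assms sublist_length_le by fastforce

section \<open>Fekete's lemma and occurrences in sequences\<close>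

text \<open>Choose \<open>m\<close> whose quotient nearly attains the infimum and divide
  \<open>n\<close> by \<open>m\<close> with remainder: the quotient at \<open>n\<close> exceeds that
  at \<open>m\<close> by at most a constant over \<open>n\<close>.\<close>

lemma fekete_subadditive:
  fixes f :: "nat \<Rightarrow> real"
  assumes sub: "\<And>m n. m \<ge> 1 \<Longrightarrow> n \<ge> 1 \<Longrightarrow> f (m + n) \<le> f m + f n"
    and lower: "\<And>n. n \<ge> 1 \<Longrightarrow> f n \<ge> - K * real n"
  shows "(\<lambda>n. f n / real n) \<longlonglongrightarrow> (INF n\<in>{1..}. f n / real n)"
proof (rule LIMSEQ_I)
  let ?l = "INF n\<in>{1..}. f n / real n"
  have bdd: "bdd_below ((\<lambda>n. f n / real n) ` {1..})"
    using lower by (intro bdd_belowI2[where m = "- K"]) (simp add: field_simps)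
  fix e :: real assume e: "e > 0"
  obtain m where m: "m \<ge> 1" "f m / real m < ?l + e / 2"
    using cINF_less_iff[OF _ bdd, of "?l + e / 2"] e by auto
  define x where "x = f m / real m"
  define B where "B = (\<Sum>r=1..m. \<bar>f r\<bar>)"
  have iter: "f (m * q + r) \<le> real q * f m + f r" if "r \<ge> 1" for q r
  proof (induction q)
    case (Suc q)
    have "f (m * Suc q + r) = f (m + (m * q + r))" by (simp add: algebra_simps)
    also have "\<dots> \<le> f m + f (m * q + r)" using m that by (intro sub) auto
    finally show ?case using Suc by (simp add: algebra_simps)
  qed simp
  have upper: "f n / real n \<le> x + (real m * \<bar>x\<bar> + B) / real n" if n: "n \<ge> 1" for n
  proof -
    \<comment> \<open>The remainder is taken in \<open>{1..m}\<close> instead of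
      \<open>{0..<m}\<close>, because subadditivity is assumed for positive arguments only.\<close>
    define q r where "q = (n - 1) div m" and "r = Suc ((n - 1) mod m)"
    have n_eq: "n = m * q + r" using n unfolding q_def r_def by simp
    have r: "1 \<le> r" "r \<le> m" using m mod_less_divisor[of m "n - 1"] unfolding r_def by linarith+
    have "f n \<le> real q * f m + f r" using iter[OF r(1)] n_eq by simp
    moreover have "\<bar>f r\<bar> \<le> B" unfolding B_def using r by (intro member_le_sum) auto
    moreover have "real q * f m = (real n - real r) * x"
      using m n_eq by (simp add: x_def)
    moreover have "- real r * x \<le> real m * \<bar>x\<bar>"
    proof -
      have "- real r * x \<le> real r * \<bar>x\<bar>" using abs_ge_minus_self[of x] mult_left_mono[of "-x" "\<bar>x\<bar>" "real r"] by simp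
      also have "\<dots> \<le> real m * \<bar>x\<bar>" using r by (intro mult_right_mono) auto
      finally show ?thesis .
    qed
    ultimately have "f n \<le> real n * x + (real m * \<bar>x\<bar> + B)" by (simp add: algebra_simps)
    then show ?thesis using n by (simp add: field_simps)
  qed
  have "(\<lambda>n. (real m * \<bar>x\<bar> + B) / real n) \<longlonglongrightarrow> 0"
    by (rule lim_const_over_n)
  then have "\<forall>\<^sub>F n in sequentially. (real m * \<bar>x\<bar> + B) / real n < e / 2"
    using e by (intro order_tendstoD(2)) auto
  then obtain n0 where n0: "\<And>n. n \<ge> n0 \<Longrightarrow> (real m * \<bar>x\<bar> + B) / real n < e / 2"
    by (auto simp: eventually_sequentially)
  show "\<exists>n0. \<forall>n\<ge>n0. norm (f n / real n - ?l) < e"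
  proof (intro exI allI impI)
    fix n assume n: "n \<ge> max 1 n0"
    then have n': "n \<ge> 1" "n \<ge> n0" by auto
    have "?l \<le> f n / real n" using n' by (intro cINF_lower bdd) auto
    moreover have "f n / real n < ?l + e"
      using upper[OF n'(1)] n0[OF n'(2)] m(2) unfolding x_def[symmetric] by linarith
    ultimately show "norm (f n / real n - ?l) < e" by (simp add: abs_less_iff)
  qed
qed

lemma sublist_map_upt_iff:
  "sublist w (map x [0..<n]) \<longleftrightarrow> (\<exists>i. i + length w \<le> n \<and> (\<forall>j<length w. x (i + j) = w ! j))"
proof
  assume "sublist w (map x [0..<n])"
  then obtain ps ss where e: "map x [0..<n] = ps @ w @ ss" by (auto simp: sublist_def)
  have len: "n = length ps + length w + length ss"
    using arg_cong[OF e, of length] by simp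
  moreover have "x (length ps + j) = w ! j" if "j < length w" for j
    using that len arg_cong[OF e, of "\<lambda>l. l ! (length ps + j)"] by (simp add: nth_append)
  ultimately show "\<exists>i. i + length w \<le> n \<and> (\<forall>j<length w. x (i + j) = w ! j)"
    by (intro exI[of _ "length ps"]) auto
next
  assume "\<exists>i. i + length w \<le> n \<and> (\<forall>j<length w. x (i + j) = w ! j)"
  then obtain i where i: "i + length w \<le> n" "\<forall>j<length w. x (i + j) = w ! j" by blast
  have "take (length w) (drop i (map x [0..<n])) = w"
    using i by (intro nth_equalityI) auto
  then show "sublist w (map x [0..<n])"
    by (metis append_take_drop_id sublist_appendI)
qed

lemma shift_funpow: "(shift ^^ i) x = (\<lambda>n. x (i + n))"
  by (induction i) (auto simp: shift_def)

section \<open>Avoiding a word\<close>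

locale stochastic_matrix =
  fixes N :: nat and P :: "nat \<Rightarrow> nat \<Rightarrow> real"
  assumes nonneg: "\<And>i j. i \<in> {1..N} \<Longrightarrow> j \<in> {1..N} \<Longrightarrow> P i j \<ge> 0"
    and row_sum: "\<And>i. i \<in> {1..N} \<Longrightarrow> (\<Sum>j=1..N. P i j) = 1"
begin

text \<open>The start vector \<open>q\<close> stays a parameter because the comparison uses two of
  them, \<open>p\<close> and the point mass at \<open>a\<close>.\<close>

definition wt :: "(nat \<Rightarrow> real) \<Rightarrow> nat list \<Rightarrow> real" where
  "wt q v = q (hd v) * delta P v"

text \<open>The argument \<open>n\<close> counts steps: the words summed over have length \<open>n + 1\<close>.\<close>
definition avoiding_at :: "(nat \<Rightarrow> real) \<Rightarrow> nat list \<Rightarrow> nat \<Rightarrow> nat \<Rightarrow> real" where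
  "avoiding_at q w n b = (\<Sum>v\<in>words N (Suc n). of_bool (\<not> sublist w v \<and> last v = b) * wt q v)"

definition avoiding :: "(nat \<Rightarrow> real) \<Rightarrow> nat list \<Rightarrow> nat \<Rightarrow> real" where
  "avoiding q w n = (\<Sum>v\<in>words N (Suc n). of_bool (\<not> sublist w v) * wt q v)"

definition first_hit :: "(nat \<Rightarrow> real) \<Rightarrow> nat list \<Rightarrow> nat \<Rightarrow> real" where
  "first_hit q w n =
     (\<Sum>v\<in>words N (Suc n). of_bool (suffix w v \<and> \<not> sublist w (butlast v)) * wt q v)"

text \<open>This is entry \<open>b\<close> of the row vector \<open>q\<close> times the
  \<open>n\<close>-th power of \<open>P\<close>.\<close>

fun walk :: "(nat \<Rightarrow> real) \<Rightarrow> nat \<Rightarrow> nat \<Rightarrow> real" where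
  "walk q 0 b = q b"
| "walk q (Suc n) b = (\<Sum>c=1..N. walk q n c * P c b)"

lemma delta_nonneg:
  assumes "set v \<subseteq> {1..N}"
  shows "delta P v \<ge> 0"
  unfolding delta_def using assms
  by (intro prod_nonneg ballI nonneg) (auto simp del: atLeastAtMost_iff intro!: subsetD[OF assms] nth_mem)

lemma P_le_1:
  assumes "i \<in> {1..N}" "j \<in> {1..N}"
  shows "P i j \<le> 1"
proof -
  have "P i j \<le> (\<Sum>j=1..N. P i j)"
    using assms nonneg by (intro member_le_sum) auto
  then show ?thesis using row_sum assms by simp
qed

lemma wt_append:
  assumes "v \<noteq> []"
  shows "wt q (v @ z) = wt q v * delta P (last v # z)"
  using assms by (simp add: wt_def delta_append)

lemma wt_snoc:
  assumes "v \<noteq> []"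
  shows "wt q (v @ [b]) = wt q v * P (last v) b"
  using assms by (simp add: wt_append delta_Cons_Cons)

lemma wt_nonneg:
  assumes "\<And>i. i \<in> {1..N} \<Longrightarrow> q i \<ge> 0" "v \<in> words N (Suc n)"
  shows "wt q v \<ge> 0"
  unfolding wt_def using assms hd_last_words[OF assms(2)]
  by (intro mult_nonneg_nonneg delta_nonneg) (auto simp: words_def)

lemma first_hit_nonneg:
  assumes "\<And>i. i \<in> {1..N} \<Longrightarrow> q i \<ge> 0"
  shows "first_hit q w n \<ge> 0"
  unfolding first_hit_def using assms by (intro sum_nonneg mult_nonneg_nonneg wt_nonneg) auto

lemma avoiding_nonneg:
  assumes "\<And>i. i \<in> {1..N} \<Longrightarrow> q i \<ge> 0"
  shows "avoiding q w n \<ge> 0"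
  unfolding avoiding_def using assms by (intro sum_nonneg mult_nonneg_nonneg wt_nonneg) auto

lemma first_hit_eq_0:
  assumes "Suc n < length w"
  shows "first_hit q w n = 0"
  unfolding first_hit_def using assms
  by (intro sum.neutral) (auto simp: words_def dest: suffix_length_le)

section \<open>Decomposition at the first occurrence\<close>

lemma avoiding_at_0:
  assumes "length w \<ge> 2" "b \<in> {1..N}"
  shows "avoiding_at q w 0 b = q b"
proof -
  have "avoiding_at q w 0 b = (\<Sum>c=1..N. of_bool (c = b) * q c)"
    unfolding avoiding_at_def sum_words_1 using assms not_sublist_singleton[OF assms(1)]
    by (intro sum.cong) (auto simp: wt_def)
  also have "\<dots> = (\<Sum>c=1..N. if c = b then q c else 0)"
    by (intro sum.cong) auto
  finally show ?thesis using assms by simp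
qed

text \<open>Appending \<open>b\<close> to a word that avoids \<open>w\<close> either preserves the
  avoidance or completes a first occurrence, and the latter needs \<open>b = last w\<close>.\<close>

lemma avoiding_at_Suc:
  assumes "w \<noteq> []" "b \<in> {1..N}"
  shows "avoiding_at q w (Suc n) b + of_bool (b = last w) * first_hit q w (Suc n)
       = (\<Sum>c=1..N. avoiding_at q w n c * P c b)"
proof -
  have if_last: "(\<Sum>c=1..N. of_bool (A \<and> c = b) * f c) = of_bool A * f b"
      if "b \<in> {1..N}" for A b and f :: "nat \<Rightarrow> real"
  proof -
    have "(\<Sum>c=1..N. of_bool (A \<and> c = b) * f c) = (\<Sum>c=1..N. if c = b then of_bool A * f c else 0)"
      by (intro sum.cong) auto
    then show ?thesis using that by simp
  qed
  have "(\<Sum>c=1..N. avoiding_at q w n c * P c b)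
      = (\<Sum>v\<in>words N (Suc n). \<Sum>c=1..N. of_bool (\<not> sublist w v \<and> c = last v) * (wt q v * P c b))"
    unfolding avoiding_at_def sum_distrib_right
    by (subst sum.swap, intro sum.cong refl) (auto simp: of_bool_def)
  also have "\<dots> = (\<Sum>v\<in>words N (Suc n). of_bool (\<not> sublist w v) * wt q (v @ [b]))"
    using hd_last_words by (intro sum.cong refl) (subst if_last, auto simp: wt_snoc words_nonempty)
  finally have rhs: "(\<Sum>c=1..N. avoiding_at q w n c * P c b)
      = (\<Sum>v\<in>words N (Suc n). of_bool (\<not> sublist w v) * wt q (v @ [b]))" .
  have "avoiding_at q w (Suc n) b
      = (\<Sum>v\<in>words N (Suc n). \<Sum>c=1..N. of_bool (\<not> sublist w (v @ [b]) \<and> c = b) * wt q (v @ [c]))"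
    unfolding avoiding_at_def sum_words_snoc[where n = "Suc n"]
    by (intro sum.cong refl) (auto simp: of_bool_def)
  then have av: "avoiding_at q w (Suc n) b
      = (\<Sum>v\<in>words N (Suc n). of_bool (\<not> sublist w (v @ [b])) * wt q (v @ [b]))"
    using assms(2) by (simp only: if_last)
  have last_eq: "c = last w" if "suffix w (v @ [c])" for v c
    using that assms(1) by (metis last_snoc last_appendR suffix_def)
  have fh: "of_bool (b = last w) * first_hit q w (Suc n)
      = (\<Sum>v\<in>words N (Suc n). of_bool (suffix w (v @ [b]) \<and> \<not> sublist w v) * wt q (v @ [b]))"
  proof (cases "b = last w")
    case True
    have "first_hit q w (Suc n)
        = (\<Sum>v\<in>words N (Suc n). \<Sum>c=1..N. of_bool ((suffix w (v @ [b]) \<and> \<not> sublist w v) \<and> c = b) * wt q (v @ [c]))"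
      unfolding first_hit_def sum_words_snoc[where n = "Suc n"] using True last_eq
      by (intro sum.cong refl arg_cong2[where f = "(*)"] arg_cong[where f = of_bool])
         (simp del: suffix_snoc, blast)
    then show ?thesis using True assms by (simp only: if_last) simp
  next
    case False
    then have "\<not> suffix w (v @ [b])" for v using last_eq by blast
    then show ?thesis using False by (simp del: suffix_snoc)
  qed
  show ?thesis
    unfolding rhs av fh sum.distrib[symmetric]
    by (intro sum.cong refl) (auto simp: sublist_snoc_iff)
qed

text \<open>A word either avoids \<open>w\<close> or can be cut at the end of its first occurrence;
  the rest is then a walk from \<open>last w\<close>. Induction with \<open>avoiding_at_Suc\<close>
  replaces the actual cutting.\<close>

lemma walk_decomposition:
  assumes "length w \<ge> 2" "b \<in> {1..N}"
  shows "walk q n b = avoiding_at q w n b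
       + (\<Sum>k\<le>n. first_hit q w k * walk (\<lambda>i. of_bool (i = last w)) (n - k) b)"
  using assms(2)
proof (induction n arbitrary: b)
  case 0
  then show ?case using assms by (simp add: avoiding_at_0 first_hit_eq_0)
next
  case (Suc n)
  let ?g = "walk (\<lambda>i. of_bool (i = last w))"
  have "walk q (Suc n) b = (\<Sum>c=1..N. avoiding_at q w n c * P c b)
      + (\<Sum>c=1..N. \<Sum>k\<le>n. first_hit q w k * ?g (n - k) c * P c b)"
    using Suc.IH by (simp add: sum.distrib[symmetric] sum_distrib_right distrib_right)
  also have "(\<Sum>c=1..N. \<Sum>k\<le>n. first_hit q w k * ?g (n - k) c * P c b)
      = (\<Sum>k\<le>n. first_hit q w k * ?g (Suc n - k) b)"
    by (subst sum.swap) (auto intro!: sum.cong simp: Suc_diff_le sum_distrib_left mult.assoc)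
  \<comment> \<open>The first hit at time \<open>Suc n\<close> becomes the summand
    \<open>k = Suc n\<close>, since the walk with 0 steps still sits at
    \<open>last w\<close>.\<close>
  also have "(\<Sum>c=1..N. avoiding_at q w n c * P c b)
      = avoiding_at q w (Suc n) b + of_bool (b = last w) * first_hit q w (Suc n)"
    using assms Suc.prems by (subst avoiding_at_Suc) auto
  finally show ?case by (simp add: mult.commute)
qed

text \<open>As the rows of \<open>P\<close> sum to 1, the avoiding mass loses at each step exactly
  the weight of the first hits.\<close>

lemma avoiding_plus_first_hit:
  assumes "length w \<ge> 2"
  shows "avoiding q w n + (\<Sum>k\<le>n. first_hit q w k) = (\<Sum>i=1..N. q i)"
proof (induction n)
  case 0
  have "avoiding q w 0 = (\<Sum>i=1..N. q i)"
    unfolding avoiding_def sum_words_1 using not_sublist_singleton[OF assms]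
    by (intro sum.cong) (auto simp: wt_def)
  then show ?case using assms by (simp add: first_hit_eq_0)
next
  case (Suc n)
  have "avoiding q w n = (\<Sum>v\<in>words N (Suc n). \<Sum>b=1..N. of_bool (\<not> sublist w v) * wt q (v @ [b]))"
    unfolding avoiding_def
    using row_sum hd_last_words
    by (intro sum.cong refl) (simp add: wt_snoc words_nonempty sum_distrib_left[symmetric] del: of_bool_not_iff)
  also have "\<dots> = avoiding q w (Suc n) + first_hit q w (Suc n)"
    unfolding avoiding_def first_hit_def sum_words_snoc[where n = "Suc n"] sum.distrib[symmetric]
    by (intro sum.cong refl) (auto simp: sublist_snoc_iff)
  finally show ?case using Suc by simp
qed

section \<open>Overlaps of a word with itself\<close>

text \<open>This is \<open>tau\<close> without the term \<open>s = length w - 1\<close>, so only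
  overlaps in at least two letters count. The overlap in the single letter \<open>a\<close> enters
  later through the walk series, whose constant term is 1.\<close>

definition autocorr :: "nat list \<Rightarrow> real fps" where
  "autocorr w = Abs_fps (\<lambda>s. if s < length w - 1 then cself s w * delta_self P s w else 0)"

text \<open>The summand \<open>s\<close> counts the words ending in \<open>w\<close> in which the first occurrence of \<open>w\<close>
  ends \<open>s\<close> letters before the end: this occurrence overlaps the last one.\<close>
lemma first_hit_autocorr_term:
  assumes "s < length w - 1" "length w - 1 \<le> n"
  shows "first_hit q w (n - s) * (cself s w * delta_self P s w)
       = (\<Sum>y\<in>words N (Suc n). of_bool (suffix w y \<and> sublist w (take (Suc n - s) y)
            \<and> \<not> sublist w (take (n - s) y)) * wt q y)"
proof -
  let ?r = "length w" and ?z = "drop (length w - s) w"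
  let ?hit = "\<lambda>t. suffix w t \<and> \<not> sublist w (butlast t)"
  have w: "w \<noteq> []" "s < ?r" "s \<le> n" using assms by auto
  \<comment> \<open>Occurring in the prefix of length \<open>Suc n - s\<close> but not in the one
    shorter by a letter means that the first occurrence ends exactly there.\<close>
  have hit_iff: "sublist w (take (Suc n - s) y) \<and> \<not> sublist w (take (n - s) y) \<longleftrightarrow> ?hit (take (Suc n - s) y)"
    if "y \<in> words N (Suc n)" for y
  proof -
    have y: "length y = Suc n" using that by (simp add: words_def)
    have e: "take (Suc n - s) y = take (n - s) y @ [y ! (n - s)]"
      using y w by (simp add: Suc_diff_le take_Suc_conv_app_nth)
    then show ?thesis by (simp add: sublist_snoc_iff del: suffix_snoc) blast
  qed
  \<comment> \<open>Two copies of \<open>w\<close> whose ends are \<open>s\<close> letters apart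
    overlap. This forces the self-overlap of \<open>w\<close> and determines the last
    \<open>s\<close> letters of \<open>y\<close>.\<close>
  have overlap: "cself s w = 1 \<and> drop (Suc n - s) y = ?z"
    if y: "y \<in> words N (Suc n)" "suffix w y" "suffix w (take (Suc n - s) y)" for y
  proof -
    obtain y0 where y0: "y = y0 @ w" using y by (auto simp: suffix_def)
    obtain t0 where t0: "take (Suc n - s) y = t0 @ w" using y by (auto simp: suffix_def)
    have len: "length y0 + ?r = Suc n" using y y0 by (simp add: words_def)
    have "length (take (Suc n - s) y) = Suc n - s" using y by (simp add: words_def)
    then have lent: "length t0 + ?r = Suc n - s" using t0 by simp
    have d: "Suc n - s - length y0 = ?r - s" using len w by simp
    have "take (Suc n - s) y = y0 @ take (?r - s) w" using y0 d w len by simp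
    then have "t0 @ w = y0 @ take (?r - s) w" using t0 by simp
    then have "drop (length y0) (t0 @ w) = take (?r - s) w" by simp
    moreover have "length y0 - length t0 = s" "length t0 \<le> length y0" using len lent w by simp_all
    ultimately have "drop s w = take (?r - s) w" by simp
    then show ?thesis using y0 d len w by (simp add: cself_def)
  qed
  show ?thesis
  proof (cases "cself s w = 1")
    case False
    then have "cself s w = 0" by (simp add: cself_def split: if_splits)
    moreover have "(\<Sum>y\<in>words N (Suc n). of_bool (suffix w y \<and> sublist w (take (Suc n - s) y)
            \<and> \<not> sublist w (take (n - s) y)) * wt q y) = 0"
      using hit_iff overlap False by (intro sum.neutral) auto
    ultimately show ?thesis by simp
  next
    case True
    then have c: "drop s w = take (?r - s) w" by (simp add: cself_def split: if_splits)
    \<comment> \<open>By the self-overlap the letter of \<open>w\<close> just before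
      \<open>?z\<close> is again \<open>last w\<close>, so \<open>last w # ?z\<close> is a suffix of
      \<open>w\<close>.\<close>
    have "last w = last (drop s w)" using w by simp
    also have "\<dots> = w ! (?r - s - 1)" using w unfolding c by (subst last_conv_nth) auto
    finally have "last w # ?z = drop (?r - Suc s) w"
      using w by (subst (2) Cons_nth_drop_Suc[symmetric]) (auto simp: Suc_diff_Suc)
    then have ds: "delta_self P s w = delta P (last w # ?z)"
      using w by (simp add: delta_self_eq_delta_drop)
    have suff: "suffix w (t @ ?z)" if t: "suffix w t" for t
    proof -
      obtain t0 where "t = t0 @ w" using t by (auto simp: suffix_def)
      then have "t @ ?z = t0 @ take s w @ drop s w @ ?z" by simp
      also have "\<dots> = (t0 @ take s w) @ w" using c by simp
      finally show ?thesis by (auto simp: suffix_def)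
    qed
    have zset: "set ?z \<subseteq> {1..N}" if "suffix w t" "t \<in> words N m" for t m
      using that order_trans[OF set_drop_subset[of "?r - s" w], of "{1..N}"]
      by (auto simp: words_def suffix_def simp del: atLeastAtMost_iff)
    have "first_hit q w (n - s) * (cself s w * delta_self P s w)
        = (\<Sum>t\<in>{t\<in>words N (Suc (n - s)). ?hit t}. wt q t * delta P (last w # ?z))"
      unfolding first_hit_def ds True sum_distrib_right
      by (intro sum.mono_neutral_cong_right) auto
    also have "\<dots> = (\<Sum>y\<in>{y\<in>words N (Suc n). suffix w y \<and> ?hit (take (Suc n - s) y)}. wt q y)"
    proof (rule sum.reindex_bij_witness[where i = "take (Suc n - s)" and j = "\<lambda>t. t @ ?z"])
      fix t assume t: "t \<in> {t\<in>words N (Suc (n - s)). ?hit t}"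
      then have lt: "length t = Suc n - s" using w by (auto simp: words_def Suc_diff_le)
      then show tk: "take (Suc n - s) (t @ ?z) = t" by simp
      show "t @ ?z \<in> {y \<in> words N (Suc n). suffix w y \<and> ?hit (take (Suc n - s) y)}"
        using t tk suff zset[of t "Suc (n - s)"] w by (auto simp: words_def)
      have "last t = last w" "t \<noteq> []" using t w by (auto simp: suffix_def)
      then show "wt q (t @ ?z) = wt q t * delta P (last w # ?z)" by (simp add: wt_append)
    next
      fix y assume y: "y \<in> {y \<in> words N (Suc n). suffix w y \<and> ?hit (take (Suc n - s) y)}"
      then have "?z = drop (Suc n - s) y" using overlap[of y] by simp
      then show "take (Suc n - s) y @ ?z = y" by simp
      show "take (Suc n - s) y \<in> {t\<in>words N (Suc (n - s)). ?hit t}"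
        using y w set_take_subset[of "Suc n - s" y] by (auto simp: words_def Suc_diff_le)
    qed
    also have "\<dots> = (\<Sum>y\<in>words N (Suc n). of_bool (suffix w y \<and> sublist w (take (Suc n - s) y)
            \<and> \<not> sublist w (take (n - s) y)) * wt q y)"
      using hit_iff by (intro sum.mono_neutral_cong_left) auto
    finally show ?thesis .
  qed
qed

text \<open>Appending \<open>tl w\<close> to a word that avoids \<open>w\<close> and ends in
  \<open>a\<close> creates a word ending in \<open>w\<close>. Its first occurrence of
  \<open>w\<close> ends \<open>s\<close> letters before the end for some
  \<open>s < length w - 1\<close>; sorting by \<open>s\<close> gives the sum.\<close>

lemma first_hit_autocorr:
  assumes "w \<noteq> []" "hd w = a" "set w \<subseteq> {1..N}" "length w - 1 \<le> n"
  shows "avoiding_at q w (n - (length w - 1)) a * delta P w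
       = (\<Sum>s<length w - 1. first_hit q w (n - s) * (cself s w * delta_self P s w))"
proof -
  let ?r = "length w"
  \<comment> \<open>Here the prefix lacking the last \<open>s\<close> letters avoids
    \<open>w\<close>. Hence \<open>h (Suc s) - h s\<close> isolates a first occurrence ending
    \<open>s\<close> letters before the end, and the sum telescopes.\<close>
  define h where "h = (\<lambda>s. \<Sum>y\<in>words N (Suc n).
    of_bool (suffix w y \<and> \<not> sublist w (take (Suc n - s) y)) * wt q y)"
  have h0: "h 0 = 0"
    unfolding h_def by (intro sum.neutral) (auto simp: words_def dest: suffix_imp_sublist)
  have "(\<Sum>s<?r - 1. first_hit q w (n - s) * (cself s w * delta_self P s w)) = (\<Sum>s<?r - 1. h (Suc s) - h s)"
  proof (intro sum.cong refl)
    fix s assume s: "s \<in> {..<?r - 1}"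
    have "take (n - s) y = take (n - s) (take (Suc n - s) y)" for y :: "nat list"
      by (simp add: min_def)
    then have "prefix (take (n - s) y) (take (Suc n - s) y)" for y :: "nat list"
      by (metis take_is_prefix)
    then have mono: "sublist w (take (n - s) y) \<Longrightarrow> sublist w (take (Suc n - s) y)" for y
      by (meson prefix_imp_sublist sublist_order.order.trans)
    show "first_hit q w (n - s) * (cself s w * delta_self P s w) = h (Suc s) - h s"
      unfolding h_def sum_subtractf[symmetric] using s assms(4)
      by (subst first_hit_autocorr_term, simp, simp, intro sum.cong refl) (auto simp: of_bool_def dest: mono)
  qed
  also have "\<dots> = h (?r - 1)" using h0 by (simp add: sum_lessThan_telescope)
  also have "\<dots> = (\<Sum>y\<in>{y\<in>words N (Suc n). suffix w y \<and> \<not> sublist w (take (Suc (n - (?r - 1))) y)}. wt q y)"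
    unfolding h_def using assms(4)
    by (intro sum.mono_neutral_cong_right) (auto simp: Suc_diff_le)
  \<comment> \<open>The prefix ends in the first letter \<open>a\<close> of the final
    \<open>w\<close>. That letter is shared, so \<open>tl w\<close> is what gets appended.\<close>
  also have "\<dots> = (\<Sum>x\<in>{x\<in>words N (Suc (n - (?r - 1))). \<not> sublist w x \<and> last x = a}. wt q x * delta P w)"
  proof (rule sum.reindex_bij_witness[where j = "take (Suc (n - (?r - 1)))" and i = "\<lambda>t. t @ tl w"])
    fix x assume x: "x \<in> {x\<in>words N (Suc (n - (?r - 1))). \<not> sublist w x \<and> last x = a}"
    then have xl: "length x = Suc (n - (?r - 1))" "x \<noteq> []" by (auto simp: words_def)
    then show tk: "take (Suc (n - (?r - 1))) (x @ tl w) = x" by simp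
    have "x = butlast x @ [a]" "w = a # tl w"
      using x xl assms(1,2) append_butlast_last_id[of x] by auto
    then have "x @ tl w = butlast x @ w"
      by (metis append_Cons append_Nil append_assoc)
    then have sf: "suffix w (x @ tl w)" by (simp add: suffix_def)
    have "set (tl w) \<subseteq> {1..N}" using assms(1,3) by (meson list.set_sel(2) subset_iff)
    then show "x @ tl w \<in> {y\<in>words N (Suc n). suffix w y \<and> \<not> sublist w (take (Suc (n - (?r - 1))) y)}"
      using x xl tk sf assms(4) by (auto simp: words_def)
  next
    fix y assume y: "y \<in> {y\<in>words N (Suc n). suffix w y \<and> \<not> sublist w (take (Suc (n - (?r - 1))) y)}"
    then obtain y0 where y0: "y = y0 @ w" by (auto simp: suffix_def)
    obtain w' where w': "w = a # w'" using assms(1,2) by (cases w) auto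
    have "length y0 = n - (?r - 1)" using y y0 w' by (auto simp: words_def)
    then have tk: "take (Suc (n - (?r - 1))) y = y0 @ [a]" using y0 w' by simp
    then show "take (Suc (n - (?r - 1))) y @ tl w = y" using y0 w' by simp
    show "take (Suc (n - (?r - 1))) y \<in> {x\<in>words N (Suc (n - (?r - 1))). \<not> sublist w x \<and> last x = a}"
      using y tk y0 w' by (auto simp: words_def)
    show "wt q (take (Suc (n - (?r - 1))) y) * delta P w = wt q y"
      unfolding tk using y0 w' wt_append[of "y0 @ [a]" q w'] by simp
  qed
  also have "\<dots> = avoiding_at q w (n - (?r - 1)) a * delta P w"
    unfolding avoiding_at_def sum_distrib_right by (intro sum.mono_neutral_cong_left) auto
  finally show ?thesis by simp
qed

section \<open>Generating functions and comparison of the avoiding masses\<close>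

lemma fps_first_hit_autocorr:
  assumes "w \<noteq> []" "hd w = a" "set w \<subseteq> {1..N}"
  shows "Abs_fps (\<lambda>n. avoiding_at q w n a) * (fps_const (delta P w) * fps_X ^ (length w - 1))
       = Abs_fps (first_hit q w) * autocorr w"
proof (rule fps_ext)
  fix n
  let ?r = "length w"
  have lhs: "fps_nth (Abs_fps (\<lambda>n. avoiding_at q w n a) * (fps_const (delta P w) * fps_X ^ (?r - 1))) n
     = (if n < ?r - 1 then 0 else avoiding_at q w (n - (?r - 1)) a * delta P w)"
    by (simp add: fps_X_power_mult_right_nth mult.assoc[symmetric])
  have rhs: "fps_nth (Abs_fps (first_hit q w) * autocorr w) n
     = (\<Sum>s=0..n. first_hit q w (n - s) * fps_nth (autocorr w) s)"
    by (subst mult.commute) (simp add: fps_mult_nth mult.commute)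
  show "fps_nth (Abs_fps (\<lambda>n. avoiding_at q w n a) * (fps_const (delta P w) * fps_X ^ (?r - 1))) n
     = fps_nth (Abs_fps (first_hit q w) * autocorr w) n"
  proof (cases "n < ?r - 1")
    case True
    \<comment> \<open>No word shorter than \<open>w\<close> ends in \<open>w\<close>, so all
      first-hit coefficients involved vanish.\<close>
    then show ?thesis unfolding lhs rhs by (auto simp: first_hit_eq_0)
  next
    case False
    then have "avoiding_at q w (n - (?r - 1)) a * delta P w
       = (\<Sum>s<?r - 1. first_hit q w (n - s) * (cself s w * delta_self P s w))"
      using assms by (intro first_hit_autocorr) auto
    also have "\<dots> = (\<Sum>s=0..n. first_hit q w (n - s) * fps_nth (autocorr w) s)"
      using False by (intro sum.mono_neutral_cong_left) (auto simp: autocorr_def)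
    finally show ?thesis unfolding lhs rhs using False by simp
  qed
qed

lemma fps_walk_decomposition:
  assumes "length w \<ge> 2" "b \<in> {1..N}" "last w = a"
  shows "Abs_fps (\<lambda>n. walk q n b) = Abs_fps (\<lambda>n. avoiding_at q w n b)
    + Abs_fps (first_hit q w) * Abs_fps (\<lambda>n. walk (\<lambda>i. of_bool (i = a)) n b)"
proof (rule fps_ext)
  show "fps_nth (Abs_fps (\<lambda>n. walk q n b)) n = fps_nth (Abs_fps (\<lambda>n. avoiding_at q w n b)
    + Abs_fps (first_hit q w) * Abs_fps (\<lambda>n. walk (\<lambda>i. of_bool (i = a)) n b)) n" for n
    using walk_decomposition[OF assms(1,2), of q n] unfolding assms(3)
    by (simp only: fps_nth_Abs_fps fps_add_nth fps_mult_nth atMost_atLeast0)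
qed

lemma fps_avoiding:
  assumes "length w \<ge> 2"
  shows "Abs_fps (avoiding q w) + Abs_fps (first_hit q w) * Abs_fps (\<lambda>_. 1)
    = fps_const (\<Sum>i=1..N. q i) * Abs_fps (\<lambda>_. 1)"
  using avoiding_plus_first_hit[OF assms]
  by (intro fps_ext) (simp add: fps_mult_nth atMost_atLeast0)

lemma fps_first_hit_walk:
  assumes "length w \<ge> 2" "hd w = a" "last w = a" "set w \<subseteq> {1..N}"
  shows "Abs_fps (\<lambda>n. walk q n a) * (fps_const (delta P w) * fps_X ^ (length w - 1))
    = Abs_fps (first_hit q w) * (autocorr w + Abs_fps (\<lambda>n. walk (\<lambda>i. of_bool (i = a)) n a)
        * (fps_const (delta P w) * fps_X ^ (length w - 1)))"
proof -
  have w: "w \<noteq> []" using assms(1) by auto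
  have a: "a \<in> {1..N}" using w assms by (metis hd_in_set subsetD)
  show ?thesis
    unfolding fps_walk_decomposition[OF assms(1) a assms(3), of q] distrib_right
      fps_first_hit_autocorr[OF w assms(2,4)]
    by (simp add: algebra_simps)
qed

text \<open>The walk series depend on the words only through \<open>a\<close>, and the monomial
  \<open>D\<close> only through weight and length. The relations for \<open>u\<close> and
  \<open>w\<close> therefore share \<open>E\<close>, \<open>G\<close> and \<open>D\<close>, which
  can be eliminated.\<close>

lemma avoiding_mono:
  assumes "length w = length u" "length u \<ge> 2"
    and "hd w = a" "last w = a" "hd u = a" "last u = a"
    and "set w \<subseteq> {1..N}" "set u \<subseteq> {1..N}"
    and "delta P w = delta P u" "autocorr u = 1"
    and q: "\<And>i. i \<in> {1..N} \<Longrightarrow> q i \<ge> 0"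
  shows "avoiding q u n \<le> avoiding q w n"
proof -
  let ?e = "\<lambda>i. of_bool (i = a) :: real"
  define D where "D = fps_const (delta P u) * fps_X ^ (length u - 1)"
  define G where "G = Abs_fps (\<lambda>n. walk ?e n a)"
  define E where "E = Abs_fps (\<lambda>n. walk q n a)"
  define J where "J = Abs_fps (\<lambda>_. 1 :: real)"
  define Tw where "Tw = Abs_fps (first_hit q w)"
  define Tu where "Tu = Abs_fps (first_hit q u)"
  define Ta where "Ta = Abs_fps (first_hit ?e u)"
  define Sw where "Sw = Abs_fps (avoiding q w)"
  define Su where "Su = Abs_fps (avoiding q u)"
  define Sa where "Sa = Abs_fps (avoiding ?e u)"
  have lw: "length w \<ge> 2" using assms(1,2) by simp
  have "u \<noteq> []" using assms(2) by auto
  then have a: "a \<in> {1..N}" using assms(5,8) by (metis hd_in_set subsetD)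
  have 1: "E * D = Tw * (autocorr w + G * D)"
    unfolding E_def D_def G_def Tw_def
    using fps_first_hit_walk[OF lw assms(3,4,7), of q, unfolded assms(1,9)] .
  have 2: "E * D = Tu * (1 + G * D)"
    unfolding E_def D_def G_def Tu_def
    using fps_first_hit_walk[OF assms(2,5,6,8), of q, unfolded assms(10)] .
  have 3: "G * D = Ta * (1 + G * D)"
    unfolding D_def G_def Ta_def
    using fps_first_hit_walk[OF assms(2,5,6,8), of ?e, unfolded assms(10)] .
  have c: "(\<Sum>i=1..N. ?e i) = 1"
    using a by (simp add: of_bool_def)
  have 4: "Sw + Tw * J = Su + Tu * J"
    using fps_avoiding[OF lw, of q] fps_avoiding[OF assms(2), of q]
    unfolding Sw_def Su_def Tw_def Tu_def J_def by simp
  have 5: "Sa + Ta * J = J"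
    using fps_avoiding[of u ?e] assms(2) c unfolding Sa_def Ta_def J_def by simp
  \<comment> \<open>Relation 3, the case of the start at \<open>a\<close>, exhibits
    \<open>1 - Ta\<close> as the inverse of \<open>1 + G * D\<close>.\<close>
  have "(1 + G * D) * (1 - Ta) = 1 + (G * D - Ta * (1 + G * D))" by (simp add: algebra_simps)
  then have inv: "(1 + G * D) * (1 - Ta) = 1" by (simp only: 3[symmetric]) simp
  have "(Tu - Tw) * (1 + G * D) = Tu * (1 + G * D) - Tw * (autocorr w + G * D) + Tw * (autocorr w - 1)"
    by (simp add: algebra_simps)
  then have "(Tu - Tw) * (1 + G * D) = Tw * (autocorr w - 1)"
    by (simp only: 1[symmetric] 2[symmetric]) simp
  then have "(Tu - Tw) * ((1 + G * D) * (1 - Ta)) = Tw * (autocorr w - 1) * (1 - Ta)"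
    by (simp add: mult.assoc[symmetric])
  then have "Tu - Tw = Tw * (autocorr w - 1) * (1 - Ta)" by (simp add: inv)
  moreover have "Sw - Su = (Tu - Tw) * J" using 4 by (simp add: left_diff_distrib eq_diff_eq diff_add_eq)
  \<comment> \<open>The factor \<open>1 - Ta\<close> has mixed signs; multiplied by \<open>J\<close>
    it becomes an avoiding series, with nonnegative coefficients.\<close>
  moreover have "(1 - Ta) * J = Sa" using 5 by (simp add: left_diff_distrib diff_eq_eq)
  ultimately have main: "Sw - Su = Tw * (autocorr w - 1) * Sa" by (simp add: mult.assoc)
  have prod_nonneg: "fps_nth (f * g) n \<ge> 0" if "\<And>n. fps_nth f n \<ge> 0" "\<And>n. fps_nth g n \<ge> 0" for f g :: "real fps" and n
    using that by (simp add: fps_mult_nth sum_nonneg)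
  \<comment> \<open>The coefficient at 0 is an empty product, equal to 1, so subtracting 1 leaves no
    negative coefficient.\<close>
  have ac: "fps_nth (autocorr w - 1) k \<ge> 0" for k
  proof (cases "k = 0")
    case True
    then show ?thesis using lw by (auto simp: autocorr_def cself_def delta_self_def)
  next
    case False
    have "set (drop m w) \<subseteq> {1..N}" for m using assms(7) set_drop_subset[of m w] by blast
    then show ?thesis
      using False by (auto simp: autocorr_def cself_def delta_self_eq_delta_drop delta_nonneg)
  qed
  have "fps_nth (Tw * (autocorr w - 1) * Sa) n \<ge> 0"
    by (intro prod_nonneg ac) (auto simp: Tw_def Sa_def intro!: first_hit_nonneg avoiding_nonneg q)
  then have "fps_nth (Sw - Su) n \<ge> 0" by (simp only: main)
  then show ?thesis by (simp add: Sw_def Su_def)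
qed

section \<open>Existence of the exponential rate\<close>

lemma avoiding_submult:
  assumes c: "c > 0" "\<And>i. i \<in> {1..N} \<Longrightarrow> c \<le> q i"
  shows "avoiding q w (Suc (m + n)) \<le> avoiding q w m * avoiding q w n / c"
proof -
  have q: "q i \<ge> 0" if "i \<in> {1..N}" for i using c(2)[OF that] c(1) by linarith
  \<comment> \<open>The joining transition is at most 1, while the start weight of \<open>y\<close>
    is at least \<open>c\<close>; exchanging one for the other costs the factor
    \<open>1 / c\<close>.\<close>
  have le: "wt q (x @ y) \<le> wt q x * wt q y / c"
    if x: "x \<in> words N (Suc m)" and y: "y \<in> words N (Suc n)" for x y
  proof -
    have dy: "delta P y \<ge> 0" using y by (intro delta_nonneg) (auto simp: words_def)
    obtain b y' where y': "y = b # y'" using words_nonempty[OF y] by (cases y) auto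
    have b: "b \<in> {1..N}" using hd_last_words[OF y] y' by simp
    have "delta P (last x # y) = P (last x) b * delta P y" by (simp add: y' delta_Cons_Cons)
    also have "\<dots> \<le> 1 * delta P y"
      using P_le_1 b hd_last_words[OF x] dy by (intro mult_right_mono) auto
    also have "\<dots> \<le> q b / c * delta P y"
      using c(1) c(2)[OF b] dy by (intro mult_right_mono) auto
    finally have "delta P (last x # y) \<le> wt q y / c" by (simp add: wt_def y')
    then have "wt q x * delta P (last x # y) \<le> wt q x * (wt q y / c)"
      using wt_nonneg[OF q x] by (intro mult_left_mono) auto
    then show ?thesis using words_nonempty[OF x] by (simp add: wt_append)
  qed
  have "avoiding q w (Suc (m + n)) = (\<Sum>x\<in>words N (Suc m). \<Sum>y\<in>words N (Suc n).
      of_bool (\<not> sublist w (x @ y)) * wt q (x @ y))"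
    unfolding avoiding_def
    by (subst sum_words_append[symmetric]) (simp only: add_Suc_right add_Suc)
  also have "\<dots> \<le> (\<Sum>x\<in>words N (Suc m). \<Sum>y\<in>words N (Suc n).
      (of_bool (\<not> sublist w x) * wt q x) * (of_bool (\<not> sublist w y) * wt q y) / c)"
  proof (intro sum_mono)
    fix x y assume xy: "x \<in> words N (Suc m)" "y \<in> words N (Suc n)"
    have "0 \<le> wt q x * wt q y / c" using xy c(1) q by (auto intro!: divide_nonneg_pos mult_nonneg_nonneg wt_nonneg)
    moreover have "sublist w x \<or> sublist w y \<Longrightarrow> sublist w (x @ y)"
      by (auto simp: sublist_append)
    ultimately show "of_bool (\<not> sublist w (x @ y)) * wt q (x @ y)
        \<le> (of_bool (\<not> sublist w x) * wt q x) * (of_bool (\<not> sublist w y) * wt q y) / c"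
      using le[OF xy] by (auto simp: of_bool_def)
  qed
  also have "\<dots> = avoiding q w m * avoiding q w n / c"
    unfolding avoiding_def sum_product by (simp add: sum_divide_distrib)
  finally show ?thesis .
qed

lemma avoiding_Suc_le:
  assumes "length w \<ge> 2" "\<And>i. i \<in> {1..N} \<Longrightarrow> q i \<ge> 0"
  shows "avoiding q w (Suc n) \<le> avoiding q w n"
proof -
  have "first_hit q w (Suc n) \<ge> 0" using assms(2) by (rule first_hit_nonneg)
  then show ?thesis
    using avoiding_plus_first_hit[OF assms(1), of q n] avoiding_plus_first_hit[OF assms(1), of q "Suc n"]
    unfolding sum.atMost_Suc by linarith
qed

text \<open>Positive mass means that some word of positive weight avoids \<open>w\<close>, and this
  single word already has \<open>n\<close> transitions of weight at least \<open>d\<close>.\<close>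

lemma avoiding_lower_bound:
  assumes c: "c > 0" "\<And>i. i \<in> {1..N} \<Longrightarrow> c \<le> q i"
    and d: "d > 0" "\<And>i j. i \<in> {1..N} \<Longrightarrow> j \<in> {1..N} \<Longrightarrow> P i j > 0 \<Longrightarrow> d \<le> P i j"
    and pos: "avoiding q w n > 0"
  shows "avoiding q w n \<ge> c * d ^ n"
proof -
  have q: "q i \<ge> 0" if "i \<in> {1..N}" for i using c(2)[OF that] c(1) by linarith
  have "\<exists>v\<in>words N (Suc n). of_bool (\<not> sublist w v) * wt q v \<noteq> 0"
    using pos unfolding avoiding_def by (metis (no_types, lifting) less_irrefl sum.neutral)
  then obtain v where v: "v \<in> words N (Suc n)" "\<not> sublist w v" "wt q v \<noteq> 0" by (auto simp: of_bool_def split: if_splits)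
  have len: "length v = Suc n" and sv: "set v \<subseteq> {1..N}" using v by (auto simp: words_def)
  have "d \<le> P (v ! i) (v ! Suc i)" if i: "i < n" for i
  proof (rule d(2))
    show *: "v ! i \<in> {1..N}" "v ! Suc i \<in> {1..N}" using i len sv by (auto simp del: atLeastAtMost_iff intro!: subsetD[OF sv])
    have "P (v ! i) (v ! Suc i) \<noteq> 0" using v(3) len i by (auto simp: wt_def delta_def)
    then show "P (v ! i) (v ! Suc i) > 0" using nonneg[OF *] by simp
  qed
  then have "(\<Prod>i<n. d) \<le> delta P v"
    unfolding delta_def len diff_Suc_1 using d(1) by (intro prod_mono) (simp add: less_imp_le)
  then have "c * d ^ n \<le> wt q v"
    unfolding wt_def using c(1) c(2)[OF hd_last_words(1)[OF v(1)]] d(1)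
    by (intro mult_mono) auto
  also have "\<dots> = of_bool (\<not> sublist w v) * wt q v" using v by simp
  also have "\<dots> \<le> avoiding q w n"
    unfolding avoiding_def using v(1) q by (intro member_le_sum) (auto intro!: mult_nonneg_nonneg wt_nonneg)
  finally show ?thesis .
qed

text \<open>Fekete's lemma gives the limit per letter. Dividing by \<open>m\<close> instead of the
  number \<open>m + Suc k\<close> of letters changes the quotient by a factor tending to 1.\<close>

lemma convergent_avoiding:
  assumes qpos: "\<And>i. i \<in> {1..N} \<Longrightarrow> q i > 0"
    and pos: "\<And>n. avoiding q w n > 0"
  shows "convergent (\<lambda>m. ln (avoiding q w (m + k)) / real m)"
proof -
  \<comment> \<open>Inserting 1 keeps both minima over nonempty sets and ensures
    \<open>d \<le> 1\<close>, which the linear lower bound uses.\<close>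
  define c where "c = Min (insert 1 (q ` {1..N}))"
  define d where "d = Min (insert 1 {x \<in> (\<lambda>(i, j). P i j) ` ({1..N} \<times> {1..N}). x > 0})"
  have c: "c > 0" "\<And>i. i \<in> {1..N} \<Longrightarrow> c \<le> q i"
    unfolding c_def using qpos by (auto simp del: Min_insert intro!: Min_le)
  have fin: "finite {x \<in> (\<lambda>(i, j). P i j) ` ({1..N} \<times> {1..N}). x > 0}" by simp
  have d: "d > 0" "d \<le> 1" "\<And>i j. i \<in> {1..N} \<Longrightarrow> j \<in> {1..N} \<Longrightarrow> P i j > 0 \<Longrightarrow> d \<le> P i j"
    unfolding d_def using fin by (auto simp del: Min_insert intro!: Min_le)
  \<comment> \<open>The argument of \<open>f\<close> counts letters, hence \<open>n - 1\<close>
    steps; subtracting \<open>ln c\<close> absorbs the factor \<open>1 / c\<close>.\<close>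
  define f where "f = (\<lambda>n. ln (avoiding q w (n - 1)) - ln c)"
  have sub: "f (m + n) \<le> f m + f n" if "m \<ge> 1" "n \<ge> 1" for m n
  proof -
    have "Suc ((m - 1) + (n - 1)) = m + n - 1" using that by simp
    then have "avoiding q w (m + n - 1) \<le> avoiding q w (m - 1) * avoiding q w (n - 1) / c"
      using avoiding_submult[where c = c and q = q and w = w and m = "m - 1" and n = "n - 1"] c
      by (simp only:)
    then have "ln (avoiding q w (m + n - 1)) \<le> ln (avoiding q w (m - 1) * avoiding q w (n - 1) / c)"
      using pos c(1) by (subst ln_le_cancel_iff) simp_all
    also have "\<dots> = ln (avoiding q w (m - 1)) + ln (avoiding q w (n - 1)) - ln c"
      using pos[of "m - 1"] pos[of "n - 1"] c(1) by (simp add: ln_mult_pos ln_div)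
    finally show ?thesis by (simp add: f_def)
  qed
  have lower: "f n \<ge> - (- ln d) * real n" if "n \<ge> 1" for n
  proof -
    have "ln (c * d ^ (n - 1)) \<le> ln (avoiding q w (n - 1))"
      using avoiding_lower_bound[OF c d(1,3) pos] c(1) d(1) pos by simp
    moreover have "ln (c * d ^ (n - 1)) = ln c + real (n - 1) * ln d"
      using c d by (simp add: ln_mult_pos ln_realpow)
    moreover have "real (n - 1) * ln d \<ge> real n * ln d"
      using d by (intro mult_right_mono_neg) auto
    ultimately show ?thesis by (simp add: f_def mult.commute)
  qed
  obtain l where l: "(\<lambda>n. f n / real n) \<longlonglongrightarrow> l" using fekete_subadditive[OF sub lower] by blast
  then have "(\<lambda>m. f (m + Suc k) / real (m + Suc k)) \<longlonglongrightarrow> l" by (rule LIMSEQ_ignore_initial_segment)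
  moreover have "(\<lambda>m. real (m + Suc k) / real m) \<longlonglongrightarrow> 1"
  proof (rule Lim_transform_eventually)
    show "(\<lambda>m. 1 + real (Suc k) / real m) \<longlonglongrightarrow> 1"
      using tendsto_add[OF tendsto_const lim_const_over_n[of "real (Suc k)"], of 1] by simp
    show "\<forall>\<^sub>F m in sequentially. 1 + real (Suc k) / real m = real (m + Suc k) / real m"
      by (rule eventually_sequentiallyI[of 1]) (simp add: field_simps)
  qed
  ultimately have "(\<lambda>m. f (m + Suc k) / real (m + Suc k) * (real (m + Suc k) / real m) + ln c / real m) \<longlonglongrightarrow> l * 1 + 0"
    by (intro tendsto_add tendsto_mult lim_const_over_n)
  \<comment> \<open>At \<open>m = 0\<close> both sides are 0, by division by zero.\<close>
  moreover have "f (m + Suc k) / real (m + Suc k) * (real (m + Suc k) / real m) + ln c / real m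
      = ln (avoiding q w (m + k)) / real m" for m
  proof -
    have "f (m + Suc k) / real (m + Suc k) * (real (m + Suc k) / real m) = f (m + Suc k) / real m"
      by (simp del: of_nat_add of_nat_Suc)
    then show ?thesis by (simp only: f_def) (simp add: diff_divide_distrib)
  qed
  ultimately show ?thesis by (auto simp: convergent_def)
qed

section \<open>Words that cannot be avoided\<close>

lemma path_contains_of_avoiding_eq_0:
  assumes qpos: "\<And>i. i \<in> {1..N} \<Longrightarrow> q i > 0"
    and "avoiding q u n = 0"
    and g: "\<And>i. g i \<in> {1..N}" "\<And>i. P (g i) (g (Suc i)) > 0"
  shows "\<exists>k. \<forall>i<length u. g (k + i) = u ! i"
proof -
  let ?v = "map g [0..<Suc n]"
  have v: "?v \<in> words N (Suc n)" using g(1) by (auto simp: words_def simp del: upt_Suc atLeastAtMost_iff)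
  have nn: "\<forall>v\<in>words N (Suc n). of_bool (\<not> sublist u v) * wt q v \<ge> 0"
    using qpos by (auto intro!: mult_nonneg_nonneg wt_nonneg simp: less_imp_le)
  \<comment> \<open>In a vanishing sum of nonnegative terms each term vanishes. As \<open>?v\<close>
    has positive weight, it must contain \<open>u\<close>.\<close>
  have "of_bool (\<not> sublist u ?v) * wt q ?v = 0"
    using assms(2) nn v unfolding avoiding_def by (subst (asm) sum_nonneg_eq_0_iff) auto
  moreover have "wt q ?v > 0"
    unfolding wt_def delta_def using g(2) qpos[OF hd_last_words(1)[OF v]]
    by (intro mult_pos_pos prod_pos) (auto simp del: upt_Suc)
  ultimately have "sublist u ?v" by (auto simp: of_bool_def split: if_splits)
  then show ?thesis using sublist_map_upt_iff by blast
qed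

text \<open>If every long path contains \<open>u\<close>, then so does the periodic path around any loop. A loop
  shorter than \<open>length u - 1\<close> would give \<open>u\<close> a forbidden period, so \<open>w\<close> does not return to \<open>a\<close>
  before its end; as the loop \<open>w\<close> contains \<open>u\<close>, the two coincide.\<close>
lemma avoiding_eq_0_unique:
  assumes qpos: "\<And>i. i \<in> {1..N} \<Longrightarrow> q i > 0"
    and zero: "avoiding q u n = 0"
    and len: "length w = length u" "length u \<ge> 2"
    and ends: "hd w = a" "last w = a" "hd u = a" "last u = a"
    and w: "set w \<subseteq> {1..N}" "\<And>i. Suc i < length w \<Longrightarrow> P (w ! i) (w ! Suc i) > 0"
    and u: "\<And>s. 0 < s \<Longrightarrow> s < length u - 1 \<Longrightarrow> cself s u = 0"
  shows "u = w"
proof -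
  let ?r = "length u"
  have ne: "w \<noteq> []" "u \<noteq> []" using len by auto
  have w0: "w ! 0 = a" "w ! (?r - 1) = a" "u ! 0 = a" "u ! (?r - 1) = a"
    using ends ne len by (simp_all add: hd_conv_nth last_conv_nth)
  have loop: "\<exists>k. \<forall>i<?r. w ! ((k + i) mod s) = u ! i" if s: "0 < s" "s \<le> ?r - 1" "w ! s = a" for s
  proof (rule path_contains_of_avoiding_eq_0[OF qpos zero])
    fix i
    have *: "i mod s < s" using s by simp
    show "w ! (i mod s) \<in> {1..N}" using * s len by (intro subsetD[OF w(1)] nth_mem) linarith
    \<comment> \<open>Wrapping around is harmless because \<open>w ! s = a = w ! 0\<close>.\<close>
    have "w ! (Suc i mod s) = w ! Suc (i mod s)" using s w0 by (simp add: mod_Suc)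
    moreover have "Suc (i mod s) < length w" using * s len by linarith
    ultimately show "P (w ! (i mod s)) (w ! (Suc i mod s)) > 0" using w(2) by simp
  qed auto
  have no_loop: "w ! s \<noteq> a" if s: "0 < s" "s < ?r - 1" for s
  proof
    assume "w ! s = a"
    then obtain k where k: "\<forall>i<?r. w ! ((k + i) mod s) = u ! i" using loop[of s] s by auto
    have "u ! (s + i) = u ! i" if "s + i < ?r" for i
    proof -
      have "(k + (s + i)) mod s = (k + i) mod s"
        by (metis add.assoc add.commute mod_add_self2)
      then show ?thesis using k that by (metis add_lessD1 add.commute)
    qed
    then have "drop s u = take (?r - s) u" using s by (intro nth_equalityI) auto
    then show False using u[OF s] by (simp add: cself_def)
  qed
  obtain k where k: "\<forall>i<?r. w ! ((k + i) mod (?r - 1)) = u ! i"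
    using loop[of "?r - 1"] w0 len by auto
  \<comment> \<open>The copy of \<open>u\<close> starts at a visit to \<open>a\<close>, which by
    \<open>no_loop\<close> is position 0 of the loop.\<close>
  have "w ! (k mod (?r - 1)) = a" using k ne w0 by (metis add.right_neutral length_greater_0_conv)
  moreover have "k mod (?r - 1) < ?r - 1" using len by simp
  ultimately have k0: "k mod (?r - 1) = 0" using no_loop by blast
  have "u ! i = w ! i" if "i < ?r" for i
  proof (cases "i = ?r - 1")
    case False
    then have i: "i < ?r - 1" using that by simp
    then have "(k + i) mod (?r - 1) = i" using k0 mod_add_left_eq[of k "?r - 1" i] by simp
    then show ?thesis using k that by metis
  qed (use w0 in simp)
  then show ?thesis using len by (intro nth_equalityI) auto
qed

end

section \<open>Escape rates\<close>

lemma space_markov_measure: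
  assumes "markov_measure N P p M"
  shows "space M = {x. \<forall>i. x i \<in> {1..N}}"
proof -
  have "space M = space (full_shift N)"
    using assms by (intro sets_eq_imp_space_eq) (simp add: markov_measure_def)
  then show ?thesis by (auto simp: full_shift_def space_PiM PiE_def Pi_def)
qed

lemma sets_markov_measure_cylinder:
  assumes "markov_measure N P p M" "set v \<subseteq> {1..N}"
  shows "{x \<in> space M. \<forall>i<length v. x i = v ! i} \<in> sets M"
proof -
  have coord: "{x \<in> space M. x i = v ! i} \<in> sets M" if "i < length v" for i
  proof -
    have "(\<lambda>x. x i) \<in> measurable (full_shift N) (count_space {1..N})"
      unfolding full_shift_def by (rule measurable_component_singleton) simp
    then have "(\<lambda>x. x i) \<in> measurable M (count_space {1..N})"
      using assms(1) measurable_cong_sets[of M "full_shift N"] unfolding markov_measure_def by blast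
    moreover have "{v ! i} \<in> sets (count_space {1..N})" using subsetD[OF assms(2) nth_mem[OF that]] by simp
    ultimately have "(\<lambda>x. x i) -` {v ! i} \<inter> space M \<in> sets M" by (rule measurable_sets)
    then show ?thesis by (simp add: vimage_def Int_def conj_commute)
  qed
  have "{x \<in> space M. \<forall>i\<in>{..<length v}. x i = v ! i} \<in> sets M"
    using coord by (intro sets.sets_Collect_finite_All) auto
  then show ?thesis by (simp only: Ball_def lessThan_iff)
qed

text \<open>An event depending on the first \<open>Suc n\<close> coordinates is a finite disjoint
  union of cylinders.\<close>

lemma
  assumes M: "markov_measure N P p M"
  shows sets_markov_measure_prefix: "{x \<in> space M. Q (map x [0..<Suc n])} \<in> sets M" (is ?sets)
    and measure_markov_measure_prefix: "measure M {x \<in> space M. Q (map x [0..<Suc n])}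
      = (\<Sum>v\<in>words N (Suc n). of_bool (Q v) * (p (hd v) * delta P v))" (is ?measure)
proof -
  interpret prob_space M using M by (simp add: markov_measure_def)
  let ?V = "{v \<in> words N (Suc n). Q v}"
  let ?C = "\<lambda>v. {x \<in> space M. \<forall>i<length v. x i = v ! i}"
  have in_C: "x \<in> ?C v \<longleftrightarrow> x \<in> space M \<and> map x [0..<Suc n] = v" if "v \<in> words N (Suc n)" for x v
    using that by (auto simp: words_def list_eq_iff_nth_eq simp del: upt_Suc)
  have in_words: "map x [0..<Suc n] \<in> words N (Suc n)" if "x \<in> space M" for x
    using that by (auto simp: space_markov_measure[OF M] words_def simp del: upt_Suc)
  have U: "{x \<in> space M. Q (map x [0..<Suc n])} = (\<Union>v\<in>?V. ?C v)" (is "?L = ?R")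
  proof (intro set_eqI iffI)
    fix x assume "x \<in> ?L"
    then have "map x [0..<Suc n] \<in> ?V" "x \<in> ?C (map x [0..<Suc n])"
      using in_words[of x] by (simp_all del: upt_Suc)
    then show "x \<in> ?R" by (rule UN_I)
  next
    fix x assume "x \<in> ?R"
    then obtain v where "v \<in> ?V" "x \<in> ?C v" by blast
    then show "x \<in> ?L" using in_C[of v x] by (simp del: upt_Suc)
  qed
  have meas: "?C v \<in> sets M" if "v \<in> ?V" for v
    using that by (intro sets_markov_measure_cylinder[OF M]) (auto simp: words_def)
  have fin: "finite ?V" by simp
  show ?sets unfolding U using fin meas by (rule sets.finite_UN)
  have "disjoint_family_on ?C ?V"
    unfolding disjoint_family_on_def
  proof (intro ballI impI equals0I)
    fix v v' x assume "v \<in> ?V" "v' \<in> ?V" "v \<noteq> v'" "x \<in> ?C v \<inter> ?C v'"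
    then show False using in_C[of v x] in_C[of v' x] by simp
  qed
  then have "measure M (\<Union>v\<in>?V. ?C v) = (\<Sum>v\<in>?V. measure M (?C v))"
    using meas by (intro finite_measure_finite_Union[OF fin]) blast+
  also have "\<dots> = (\<Sum>v\<in>?V. p (hd v) * delta P v)"
  proof (intro sum.cong refl)
    fix v assume "v \<in> ?V"
    then have "v \<noteq> []" "set v \<subseteq> {1..N}" by (auto simp: words_def)
    then show "measure M (?C v) = p (hd v) * delta P v"
      using M unfolding markov_measure_def by blast
  qed
  also have "\<dots> = (\<Sum>v\<in>words N (Suc n). of_bool (Q v) * (p (hd v) * delta P v))"
    by (intro sum.mono_neutral_cong_left) auto
  finally show ?measure unfolding U .
qed

text \<open>The windows starting at times 0 to \<open>m\<close> cover \<open>m + length w\<close>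
  letters. Restricting to \<open>SigmaA\<close> changes nothing, since each of the countably many
  forbidden transitions is a null event.\<close>

lemma measure_survivors:
  assumes M: "markov_measure N P p M" and P: "row_stochastic_compatible N A P"
    and w: "w \<noteq> []"
  shows "measure M (survivors N A (cyl N A w) m)
    = (\<Sum>v\<in>words N (m + length w). of_bool (\<not> sublist w v) * (p (hd v) * delta P v))"
proof -
  interpret prob_space M using M by (simp add: markov_measure_def)
  obtain n where n: "m + length w = Suc n" using w by (cases "m + length w") auto
  let ?Z = "{x \<in> space M. \<not> sublist w (map x [0..<Suc n])}"
  let ?bad = "\<lambda>k v. A (v ! k) (v ! Suc k) \<noteq> (1::nat)"
  have bad_eq: "{x \<in> space M. A (x k) (x (Suc k)) \<noteq> 1} = {x \<in> space M. ?bad k (map x [0..<Suc (Suc k)])}" for k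
    by (auto simp: nth_append)
  have bad_sets: "{x \<in> space M. A (x k) (x (Suc k)) \<noteq> 1} \<in> sets M" for k
    unfolding bad_eq by (rule sets_markov_measure_prefix[OF M, of "?bad k"])
  have "measure M {x \<in> space M. A (x k) (x (Suc k)) \<noteq> 1} = 0" for k
    unfolding bad_eq measure_markov_measure_prefix[OF M, of "?bad k"]
  proof (rule sum.neutral, rule ballI)
    fix v assume v: "v \<in> words N (Suc (Suc k))"
    then have "set v \<subseteq> {1..N}" "k < length v" "Suc k < length v" by (auto simp: words_def)
    then have "v ! k \<in> {1..N}" "v ! Suc k \<in> {1..N}" using nth_mem by blast+
    then have "?bad k v \<Longrightarrow> P (v ! k) (v ! Suc k) = 0"
      using P unfolding row_stochastic_compatible_def by force
    then have "?bad k v \<Longrightarrow> delta P v = 0"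
      using v unfolding delta_def words_def by (intro prod_zero bexI[of _ k]) auto
    then show "of_bool (?bad k v) * (p (hd v) * delta P v) = 0" by auto
  qed
  then have "AE x in M. A (x k) (x (Suc k)) = 1" for k
    using bad_sets[of k] AE_iff_measurable[OF bad_sets[of k], of "\<lambda>x. A (x k) (x (Suc k)) = 1"]
    by (simp add: emeasure_eq_measure)
  then have ae: "AE x in M. \<forall>k. A (x k) (x (Suc k)) = 1" by (simp add: AE_all_countable)
  have good_sets: "{x \<in> space M. \<forall>k. A (x k) (x (Suc k)) = 1} \<in> sets M"
  proof (intro sets.sets_Collect_countable_All)
    show "{x \<in> space M. A (x k) (x (Suc k)) = 1} \<in> sets M" for k
      using sets.sets_Collect_neg[OF bad_sets[of k]] by simp
  qed
  have SigmaA: "SigmaA N A = {x \<in> space M. \<forall>k. A (x k) (x (Suc k)) = 1}"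
    by (auto simp: SigmaA_def space_markov_measure[OF M])
  have hit: "(\<exists>i\<le>m. (shift ^^ i) x \<in> cyl N A w) \<longleftrightarrow> sublist w (map x [0..<Suc n])" if x: "x \<in> SigmaA N A" for x
  proof -
    have "(shift ^^ i) x \<in> SigmaA N A" for i
      using x by (auto simp: SigmaA_def shift_funpow)
    then have "(\<exists>i\<le>m. (shift ^^ i) x \<in> cyl N A w) \<longleftrightarrow> (\<exists>i\<le>m. \<forall>j<length w. x (i + j) = w ! j)"
      by (simp add: cyl_def shift_funpow)
    then show ?thesis unfolding sublist_map_upt_iff n[symmetric] by simp
  qed
  have surv: "survivors N A (cyl N A w) m = SigmaA N A \<inter> ?Z"
    unfolding survivors_def using hit by (auto simp: SigmaA simp del: upt_Suc)
  have Z: "?Z \<in> sets M" by (rule sets_markov_measure_prefix[OF M, of "\<lambda>v. \<not> sublist w v"])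
  have "measure M (survivors N A (cyl N A w) m) = measure M ?Z"
    unfolding surv using ae Z good_sets
    by (intro finite_measure_eq_AE) (auto simp: SigmaA simp del: upt_Suc)
  then show ?thesis unfolding measure_markov_measure_prefix[OF M, of "\<lambda>v. \<not> sublist w v"] n .
qed

text \<open>Some entry is positive; stationarity carries positivity along edges, and irreducibility
  reaches every letter.\<close>

lemma stationary_vector_pos:
  assumes A: "zero_one_matrix N A" "irreducible_matrix N A"
    and P: "row_stochastic_compatible N A P" and p: "stationary_vector N P p"
    and j: "j \<in> {1..N}"
  shows "p j > 0"
proof -
  have "\<exists>i\<in>{1..N}. p i > 0"
  proof (rule ccontr)
    assume "\<not> ?thesis"
    then have "(\<Sum>i=1..N. p i) \<le> 0" by (intro sum_nonpos) force
    then show False using p by (simp add: stationary_vector_def)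
  qed
  then obtain i where i: "i \<in> {1..N}" "p i > 0" by blast
  have reach: "matpow N A n i j > 0 \<Longrightarrow> p j > 0" if "j \<in> {1..N}" for n j
    using that
  proof (induction n arbitrary: j)
    case 0
    then show ?case using i by (simp split: if_splits)
  next
    case (Suc n)
    have "\<exists>k\<in>{1..N}. matpow N A n i k * A k j \<noteq> 0"
      using Suc.prems(1) by (metis (no_types, lifting) less_irrefl matpow.simps(2) sum.neutral)
    then obtain k where k: "k \<in> {1..N}" "matpow N A n i k > 0" "A k j \<noteq> 0" by auto
    then have "A k j = 1" using A(1) Suc.prems(2) unfolding zero_one_matrix_def by force
    then have "P k j > 0" using P k Suc.prems(2) unfolding row_stochastic_compatible_def by blast
    then have "0 < p k * P k j" using Suc.IH k by simp
    also have "\<dots> \<le> (\<Sum>i=1..N. p i * P i j)"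
      using k Suc.prems(2) P p unfolding row_stochastic_compatible_def stationary_vector_def
      by (intro member_le_sum) auto
    finally show ?case using p Suc.prems(2) by (simp add: stationary_vector_def)
  qed
  show ?thesis using A(2) i(1) j reach unfolding irreducible_matrix_def by blast
qed

section \<open>Comparison of the escape rates\<close>

lemma coeff_tau:
  assumes "s < length v"
  shows "coeff (tau P v) s = cself s v * delta_self P s v"
  using assms by (simp add: tau_def coeff_sum)

theorem theorem5p2:
  fixes N :: nat and A :: "nat \<Rightarrow> nat \<Rightarrow> nat" and P :: "nat \<Rightarrow> nat \<Rightarrow> real"
    and p :: "nat \<Rightarrow> real" and M :: "(nat \<Rightarrow> nat) measure" and u w :: "nat list"
  assumes "zero_one_matrix N A" and "irreducible_matrix N A"
    and "row_stochastic_compatible N A P" and "stationary_vector N P p"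
    and "markov_measure N P p M"
    and "allowed_word N A u" and "length u \<ge> 2"
    and "tau P u = 1 + monom (delta P u) (length u - 1)"
    and "w \<in> lang N A (length u)"
    and "hd w = hd u" and "last u = hd u" and "last w = hd u"
    and "delta P w = delta P u"
  shows "escape_rate N A M (cyl N A w) \<le> escape_rate N A M (cyl N A u)"
proof -
  interpret stochastic_matrix N P
    using assms(3) by unfold_locales (auto simp: row_stochastic_compatible_def)
  let ?r = "length u"
  have p: "p i > 0" if "i \<in> {1..N}" for i using stationary_vector_pos[OF assms(1-4) that] .
  then have p0: "p i \<ge> 0" if "i \<in> {1..N}" for i using that by (simp add: less_imp_le)
  have u: "u \<noteq> []" "set u \<subseteq> {1..N}" using assms(6) by (auto simp: allowed_word_def)
  have w: "w \<noteq> []" "set w \<subseteq> {1..N}" "length w = ?r" "allowed_word N A w"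
    using assms(9) by (auto simp: lang_def allowed_word_def)
  have Ppos: "P (v ! i) (v ! Suc i) > 0" if v: "allowed_word N A v" "Suc i < length v" for v i
  proof -
    have "set v \<subseteq> {1..N}" "A (v ! i) (v ! Suc i) = 1" using v by (auto simp: allowed_word_def)
    moreover from this have "v ! i \<in> {1..N}" "v ! Suc i \<in> {1..N}"
      using v(2) Suc_lessD[OF v(2)] nth_mem by blast+
    ultimately show ?thesis using assms(3) unfolding row_stochastic_compatible_def by blast
  qed
  have tau_coeff: "cself s u * delta_self P s u = of_bool (s = 0)" if s: "s < ?r - 1" for s
  proof -
    have "coeff (tau P u) s = of_bool (s = 0)" using s unfolding assms(8) by (simp add: coeff_1)
    then show ?thesis using s by (simp add: coeff_tau)
  qed
  \<comment> \<open>All transitions of \<open>u\<close> are positive, so a vanishing coefficient of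
    \<open>tau\<close> excludes the overlap itself.\<close>
  have cself_u: "cself s u = 0" if s: "0 < s" "s < ?r - 1" for s
  proof -
    have "delta_self P s u > 0"
      unfolding delta_self_def
    proof (rule prod_pos)
      fix j assume "j \<in> {?r - s..?r - 1}"
      then have "Suc (j - 1) = j" "j < ?r" using s by auto
      then show "P (u ! (j - 1)) (u ! j) > 0" using Ppos[OF assms(6), of "j - 1"] by simp
    qed
    then show ?thesis using tau_coeff[OF s(2)] s by simp
  qed
  have ac: "autocorr u = 1"
    using tau_coeff assms(7) by (intro fps_ext) (auto simp: autocorr_def)
  define k where "k = ?r - 1"
  have surv: "measure M (survivors N A (cyl N A v) m) = avoiding p v (m + k)"
    if "v \<noteq> []" "length v = ?r" for v m
  proof -
    have "m + length v = Suc (m + k)" using that assms(7) by (simp add: k_def)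
    then show ?thesis
      using measure_survivors[OF assms(5,3) that(1), of m] by (simp only: avoiding_def wt_def)
  qed
  have rate: "escape_rate N A M (cyl N A v) = - lim (\<lambda>m. ln (avoiding p v (m + k)) / real m)"
    if "v \<noteq> []" "length v = ?r" for v
    unfolding escape_rate_def using surv[OF that] by simp
  have le: "avoiding p u n \<le> avoiding p w n" for n
    by (rule avoiding_mono[OF w(3) assms(7,10,12) refl assms(11) w(2) u(2) assms(13) ac]) (rule p0)
  have nn: "avoiding p v n \<ge> 0" for v n using p0 by (rule avoiding_nonneg)
  \<comment> \<open>Avoiding masses do not increase, so once 0 they stay 0; with
    \<open>ln 0 = 0\<close> the sequence is eventually 0.\<close>
  have rate_0: "escape_rate N A M (cyl N A v) = 0"
    if v: "v \<noteq> []" "length v = ?r" and n: "avoiding p v n = 0" for v n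
  proof -
    have "avoiding p v (n + j) = 0" for j
    proof (induction j)
      case (Suc j)
      have "avoiding p v (Suc (n + j)) \<le> avoiding p v (n + j)"
        using assms(7) v p0 by (intro avoiding_Suc_le) auto
      then show ?case using Suc nn[of v "Suc (n + j)"] by simp
    qed (use n in simp)
    then have "avoiding p v (m + k) = 0" if "m \<ge> n" for m
      using that by (metis add.assoc le_add_diff_inverse)
    then have "(\<lambda>m. ln (avoiding p v (m + k)) / real m) \<longlonglongrightarrow> 0"
      by (intro tendsto_eventually eventually_sequentiallyI[of n]) simp
    then show ?thesis using rate[OF v] by (simp add: limI)
  qed
  consider "u = w" | n where "avoiding p w n = 0" | "u \<noteq> w" "\<And>n. avoiding p w n > 0"
    using nn[of w] by (metis less_eq_real_def)
  then show ?thesis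
  proof cases
    case 1
    then show ?thesis by simp
  next
    case 2
    then have "avoiding p u n = 0" using le[of n] nn[of u n] by simp
    then show ?thesis using rate_0 2 u w by simp
  next
    case 3
    \<comment> \<open>Positivity of both masses is what makes the logarithms monotone and their
      limits exist; for \<open>u\<close> it follows from \<open>u \<noteq> w\<close>.\<close>
    have pos: "avoiding p u n > 0" for n
    proof (rule ccontr)
      assume "\<not> avoiding p u n > 0"
      then have "avoiding p u n = 0" using nn[of u n] by simp
      then have "u = w"
        by (rule avoiding_eq_0_unique[where q = p and a = "hd u", rotated])
           (fact p w(2,3) assms(7,10-12) refl Ppos[OF w(4)] cself_u)+
      then show False using 3 by simp
    qed
    have "lim (\<lambda>m. ln (avoiding p u (m + k)) / real m) \<le> lim (\<lambda>m. ln (avoiding p w (m + k)) / real m)"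
    proof (rule LIMSEQ_le)
      show "(\<lambda>m. ln (avoiding p u (m + k)) / real m) \<longlonglongrightarrow> lim (\<lambda>m. ln (avoiding p u (m + k)) / real m)"
        using convergent_avoiding[OF p pos] by (simp add: convergent_LIMSEQ_iff)
      show "(\<lambda>m. ln (avoiding p w (m + k)) / real m) \<longlonglongrightarrow> lim (\<lambda>m. ln (avoiding p w (m + k)) / real m)"
        using convergent_avoiding[OF p 3(2)] by (simp add: convergent_LIMSEQ_iff)
      show "\<exists>n. \<forall>m\<ge>n. ln (avoiding p u (m + k)) / real m \<le> ln (avoiding p w (m + k)) / real m"
        using le pos 3(2) by (intro exI[of _ 0] allI impI divide_right_mono) auto
    qed
    then show ?thesis using rate u w by simp
  qed
qed

end
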